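(* Let $X$ be an infinite compact metrizable abelian group and let $K\subset X$ be an uncountable Kronecker set. Then the subgroup $\langle K\rangle$ of $X$ generated by $K$ is not polishable. In particular, $\langle K\rangle$ cannot be characterized, i.e. there is no sequence $\mathbf{u}=\{u_n\}$ in $\widehat{X}$ with $\langle K\rangle=s_{\mathbf{u}}(X)$.
   Context: $\mathbb{T}=\{z\in\mathbb{C}:|z|=1\}$; $\widehat{X}$ is the group of continuous characters $X\to\mathbb{T}$; $(\chi,x)$ is the value of $\chi$ at $x$. A subset $K$ of an infinite compact metrizable abelian group $X$ is a Kronecker set if it is nonempty, compact, and for every continuous function $f:K\to\mathbb{T}$ and every $\varepsilon>0$ there is $\chi\in\widehat{X}$ with $\max_{x\in K}|f(x)-(\chi,x)|<\varepsilon$. A Borel subgroup $G$ of a Polish group $X$ is polishable if there is a Polish group topology $\tau$ on $G$ such that the inclusion map $(G,\tau)\to X$ is continuous. (The subgroup $\langle K\rangle$ is $\sigma$-compact, hence Borel.) For a sequence $\mathbf{u}=\{u_n\}$ in $\widehat{X}$, $s_{\mathbf{u}}(X)=\{x\in X:(u_n,x)\to1\}$. *)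

theory Defs
  imports
    "HOL-Analysis.Analysis"
    "HOL-Computational_Algebra.Group_Closure"
begin

definition character_group :: "('a::topological_ab_group_add \<Rightarrow> complex) set" where
  "character_group =
     {\<phi>. continuous_on UNIV \<phi> \<and> range \<phi> \<subseteq> sphere 0 1 \<and> (\<forall>x y. \<phi> (x + y) = \<phi> x * \<phi> y)}"

text \<open>Since \<open>K\<close> is compact and nonempty, the maximum of \<open>norm (f x - \<phi> x)\<close> over \<open>K\<close> is attained,
  so it is below \<open>\<epsilon>\<close> iff all the values are.\<close>

definition kronecker_set :: "'a::topological_ab_group_add set \<Rightarrow> bool" where
  "kronecker_set K \<longleftrightarrow> K \<noteq> {} \<and> compact K \<and>
     (\<forall>f :: 'a \<Rightarrow> complex. continuous_on K f \<and> f ` K \<subseteq> sphere 0 1 \<longrightarrow>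
        (\<forall>\<epsilon>>0. \<exists>\<phi>\<in>character_group. \<forall>x\<in>K. norm (f x - \<phi> x) < \<epsilon>))"

text \<open>The topology \<open>\<tau>\<close> lives on the subset \<open>G\<close> and is in general not the subspace topology, hence
  the abstract type \<^typ>\<open>'a topology\<close>. The two continuity conditions entail that \<open>G\<close> is
  closed under the group operations.\<close>

definition polish_group_topology_on :: "'a::ab_group_add set \<Rightarrow> 'a topology \<Rightarrow> bool" where
  "polish_group_topology_on G \<tau> \<longleftrightarrow>
     topspace \<tau> = G \<and> completely_metrizable_space \<tau> \<and> second_countable \<tau> \<and>
     continuous_map (prod_topology \<tau> \<tau>) \<tau> (\<lambda>(x, y). x + y) \<and>
     continuous_map \<tau> \<tau> uminus"

text \<open>Polishability is a notion for Borel subgroups \<open>G\<close>. Borel measurability is a precondition and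
  not part of the predicate, so that its negation really says that no such topology exists; see
  \<open>borel_group_closure\<close> below for the subgroups generated by compact sets.\<close>

definition polishable :: "'a::topological_ab_group_add set \<Rightarrow> bool" where
  "polishable G \<longleftrightarrow>
     (\<exists>\<tau>. polish_group_topology_on G \<tau> \<and> continuous_map \<tau> euclidean (\<lambda>x. x))"

definition s_set :: "(nat \<Rightarrow> 'a \<Rightarrow> complex) \<Rightarrow> 'a::topological_ab_group_add set" where
  "s_set u = {x. (\<lambda>n. u n x) \<longlonglongrightarrow> 1}"

definition characterized :: "'a::topological_ab_group_add set \<Rightarrow> bool" where
  "characterized G \<longleftrightarrow> (\<exists>u. (\<forall>n. u n \<in> character_group) \<and> G = s_set u)"

lemma borel_group_closure:
  fixes K :: "'a::topological_ab_group_add set"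
  assumes met: "metrizable_space (euclidean :: 'a topology)" and K: "compact K"
  shows "group_closure K \<in> sets borel"
proof -
  define P where "P = rec_nat (insert 0 K) (\<lambda>_ A. (\<lambda>p. fst p - snd p) ` (A \<times> A))"
  have P0: "P 0 = insert 0 K" and PS: "P (Suc n) = (\<lambda>p. fst p - snd p) ` (P n \<times> P n)" for n
    by (simp_all add: P_def)
  have zero: "0 \<in> P n" for n
    by (induction n) (force simp: P0 PS)+
  have "P n \<subseteq> P (Suc n)" for n
    using zero[of n] by (force simp: PS)
  then have mono: "P m \<subseteq> P n" if "m \<le> n" for m n
    using that by (rule lift_Suc_mono_le)
  have cont: "continuous_on S (\<lambda>p::'a \<times> 'a. fst p - snd p)" for S
    unfolding continuous_on_def diff_conv_add_uminus by (intro ballI tendsto_intros)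
  have "compact (P n)" for n
    by (induction n) (auto simp: P0 PS K intro!: compact_insert compact_continuous_image cont compact_Times)
  then have "closed (P n)" for n
    using compactin_imp_closedin[OF metrizable_imp_Hausdorff_space[OF met], of "P n"] by simp
  moreover have "group_closure K = (\<Union>n. P n)"
  proof
    show "group_closure K \<subseteq> (\<Union>n. P n)"
    proof
      fix x assume "x \<in> group_closure K"
      then show "x \<in> (\<Union>n. P n)"
      proof induction
        case (base s)
        then show ?case using P0 by blast
      next
        case (diff s t)
        then obtain m n where "s \<in> P m" "t \<in> P n" by blast
        then have "s \<in> P (max m n)" "t \<in> P (max m n)"
          using mono[of m "max m n"] mono[of n "max m n"] by auto
        then have "s - t \<in> P (Suc (max m n))" by (force simp: PS)
        then show ?case by blast
      qed
    qed
    have "P n \<subseteq> group_closure K" for n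
      by (induction n) (auto simp: P0 PS subset_iff intro: group_closure.intros)
    then show "(\<Union>n. P n) \<subseteq> group_closure K" by blast
  qed
  ultimately show ?thesis by (auto intro: borel_closed)
qed

end

theory Submission
  imports Defs
begin

text \<open>The group generated by \<open>K\<close> is the increasing union of compact layers, where every element of
  the layer \<open>n\<close> is a signed sum of at most \<open>2 ^ n\<close> elements of \<open>K\<close> (\<open>group_closure_eq_UN_diff_layer\<close>,
  \<open>compact_diff_layer\<close>).  In a finer Polish group topology the Baire category theorem turns one of
  them into a neighbourhood of \<open>0\<close>.  A neighbourhood of \<open>0\<close> contains \<open>m (z - x)\<close> whenever \<open>z\<close> is
  close enough to \<open>x\<close>; but for distinct points of a Kronecker set and \<open>m > 2 ^ n\<close>, the element
  \<open>m (z - x)\<close> is never in the layer \<open>n\<close> (\<open>kronecker_multiple_notin_diff_layer\<close>).  So \<open>K\<close> is discrete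
  in the finer topology, and second countability makes it countable
  (\<open>not_polishable_if_multiples_leave_diff_layers\<close>).

  The key fact about Kronecker sets is metric rather than combinatorial: characters can approximate
  a function on \<open>K\<close> with values in a short arc around \<open>1\<close>, and along a signed sum of few elements of
  \<open>K\<close> the angle cannot grow enough to reach the value forced at \<open>m (x - y)\<close>
  (\<open>diff_layer_limit_angle\<close>).  This avoids unique representation of elements as words in \<open>K\<close>.

  A characterized subgroup of a compact metrizable group is polishable
  (\<open>characterized_imp_polishable\<close>): a topology is given by the distance of points together with
  the uniform distance of the sequences \<open>(u n x)\<close>.  So the second claim follows from the first.\<close>


section \<open>Characters\<close>

lemma character_zero: "\<phi> 0 = 1" if "\<phi> \<in> character_group"
proof -
  have "\<phi> (0 + 0) = \<phi> 0 * \<phi> 0" "norm (\<phi> 0) = 1"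
    using that unfolding character_group_def by (blast, force)
  then show ?thesis by auto
qed

lemma norm_character: "norm (\<phi> x) = 1" if "\<phi> \<in> character_group"
  using that unfolding character_group_def by force

lemma character_add: "\<phi> (x + y) = \<phi> x * \<phi> y" if "\<phi> \<in> character_group"
  using that unfolding character_group_def by blast

lemma character_diff: "\<phi> (x - y) = \<phi> x / \<phi> y" if "\<phi> \<in> character_group"
proof -
  have "\<phi> x = \<phi> (x - y) * \<phi> y"
    using character_add[OF that, of "x - y" y] by simp
  moreover have "\<phi> y \<noteq> 0" using norm_character[OF that, of y] by auto
  ultimately show ?thesis by simp
qed

lemma character_multiple: "\<phi> (\<Sum>i<m. x) = \<phi> x ^ m" if "\<phi> \<in> character_group" for m :: nat
  by (induction m) (simp_all add: character_zero[OF that] character_add[OF that])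

lemma continuous_on_character: "continuous_on S \<phi>" if "\<phi> \<in> character_group"
  using that unfolding character_group_def by (auto intro: continuous_on_subset)

section \<open>The layers of a generated subgroup\<close>

primrec diff_layer :: "'a::ab_group_add set \<Rightarrow> nat \<Rightarrow> 'a set" where
  "diff_layer K 0 = insert 0 K"
| "diff_layer K (Suc n) = (\<lambda>p. fst p - snd p) ` (diff_layer K n \<times> diff_layer K n)"

lemma zero_in_diff_layer: "0 \<in> diff_layer K n"
  by (induction n) force+

lemma diff_layer_mono: "m \<le> n \<Longrightarrow> diff_layer K m \<subseteq> diff_layer K n"
proof (rule lift_Suc_mono_le[of "diff_layer K"])
  show "diff_layer K n \<subseteq> diff_layer K (Suc n)" for n
    using zero_in_diff_layer[of K n] by force
qed

lemma group_closure_eq_UN_diff_layer: "group_closure K = (\<Union>n. diff_layer K n)"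
proof
  show "group_closure K \<subseteq> (\<Union>n. diff_layer K n)"
  proof
    fix x assume "x \<in> group_closure K"
    then show "x \<in> (\<Union>n. diff_layer K n)"
    proof induction
      case (base s)
      then have "s \<in> diff_layer K 0" by simp
      then show ?case by blast
    next
      case (diff s t)
      then obtain m n where "s \<in> diff_layer K m" "t \<in> diff_layer K n" by blast
      then have "s \<in> diff_layer K (max m n)" "t \<in> diff_layer K (max m n)"
        using diff_layer_mono[of m "max m n" K] diff_layer_mono[of n "max m n" K] by auto
      then have "s - t \<in> diff_layer K (Suc (max m n))" by force
      then show ?case by blast
    qed
  qed
  have "diff_layer K n \<subseteq> group_closure K" for n
    by (induction n) (auto simp: subset_iff intro: group_closure.intros)
  then show "(\<Union>n. diff_layer K n) \<subseteq> group_closure K" by blast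
qed

text \<open>In a Hausdorff group the layers are therefore closed, and they remain closed in every finer
  topology, so that the Baire category theorem applies to them.\<close>

lemma compact_diff_layer:
  fixes K :: "'a::topological_ab_group_add set"
  assumes "compact K"
  shows "compact (diff_layer K n)"
proof -
  have "continuous_on S (\<lambda>p::'a \<times> 'a. fst p - snd p)" for S
    unfolding continuous_on_def diff_conv_add_uminus by (intro ballI tendsto_intros)
  then show ?thesis
    by (induction n) (auto simp: assms intro!: compact_insert compact_continuous_image compact_Times)
qed

text \<open>If characters converge on \<open>K\<close> to \<open>cis \<circ> h\<close>, then on the generated group they converge to the
  homomorphic extension of \<open>cis \<circ> h\<close>.  An element of the layer \<open>n\<close> is a signed sum of at most \<open>2 ^ n\<close>
  elements of \<open>K\<close>, so a small angle on \<open>K\<close> stays quantitatively small on the layer.  Angles are real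
  numbers here, and not classes modulo \<open>2 * pi\<close>, so that their size makes sense.\<close>

lemma diff_layer_limit_angle:
  assumes \<phi>: "\<And>j. \<phi> j \<in> character_group"
    and lim: "\<And>k. k \<in> K \<Longrightarrow> (\<lambda>j. \<phi> j k) \<longlonglongrightarrow> cis (h k)"
    and h: "\<And>k. k \<in> K \<Longrightarrow> \<bar>h k\<bar> \<le> c" and "0 \<le> c"
    and z: "z \<in> diff_layer K n"
  shows "\<exists>s. \<bar>s\<bar> \<le> 2 ^ n * c \<and> (\<lambda>j. \<phi> j z) \<longlonglongrightarrow> cis s"
  using z
proof (induction n arbitrary: z)
  case 0
  show ?case
  proof (cases "z \<in> K")
    case True
    then show ?thesis using lim h by auto
  next
    case False
    with 0 have "z = 0" by simp
    then show ?thesis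
      using \<open>0 \<le> c\<close> by (intro exI[of _ 0]) (simp add: character_zero[OF \<phi>])
  qed
next
  case (Suc n)
  then obtain a b where ab: "z = a - b" "a \<in> diff_layer K n" "b \<in> diff_layer K n" by auto
  obtain s t where "\<bar>s\<bar> \<le> 2 ^ n * c" "(\<lambda>j. \<phi> j a) \<longlonglongrightarrow> cis s"
      and "\<bar>t\<bar> \<le> 2 ^ n * c" "(\<lambda>j. \<phi> j b) \<longlonglongrightarrow> cis t"
    using Suc.IH ab(2,3) by meson
  moreover from this have "(\<lambda>j. \<phi> j a / \<phi> j b) \<longlonglongrightarrow> cis s / cis t"
    by (intro tendsto_divide) auto
  ultimately show ?case
    by (intro exI[of _ "s - t"]) (simp add: ab(1) character_diff[OF \<phi>] cis_divide)
qed

section \<open>Kronecker sets\<close>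

lemma kronecker_characters_tendsto:
  fixes f :: "'a::topological_ab_group_add \<Rightarrow> complex"
  assumes "kronecker_set K" "continuous_on K f" "f ` K \<subseteq> sphere 0 1"
  obtains \<phi> where "\<And>j. \<phi> j \<in> character_group"
    and "\<And>k. k \<in> K \<Longrightarrow> (\<lambda>j::nat. \<phi> j k) \<longlonglongrightarrow> f k"
proof -
  have "\<forall>j. \<exists>\<phi>\<in>character_group. \<forall>k\<in>K. norm (f k - \<phi> k) < inverse (of_nat (Suc j))"
    using assms unfolding kronecker_set_def by simp
  then obtain \<phi> where \<phi>: "\<And>j. \<phi> j \<in> character_group"
      "\<And>j k. k \<in> K \<Longrightarrow> norm (f k - \<phi> j k) < inverse (of_nat (Suc j))"
    by metis
  have "(\<lambda>j. \<phi> j k) \<longlonglongrightarrow> f k" if "k \<in> K" for k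
  proof -
    have "(\<lambda>j. \<phi> j k - f k) \<longlonglongrightarrow> 0"
      using \<phi>(2)[OF that]
      by (intro Lim_null_comparison[OF _ LIMSEQ_inverse_real_of_nat] always_eventually allI)
        (auto simp: norm_minus_commute less_imp_le)
    then show ?thesis by (simp add: LIM_zero_iff)
  qed
  with \<phi>(1) show thesis by (rule that)
qed

text \<open>Points of a Kronecker set are independent enough that no multiple \<open>m (x - y)\<close> can be shortened.
  Take a Urysohn function \<open>g\<close> with \<open>g x = 1\<close>, \<open>g y = 0\<close> and characters tending to \<open>cis (g / m)\<close> on \<open>K\<close>.
  They tend to \<open>cis 1\<close> at \<open>m (x - y)\<close>, but at a point of the layer \<open>n\<close> they tend to \<open>cis s\<close> with
  \<open>\<bar>s\<bar> \<le> 2 ^ n / m < 1\<close>.\<close>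

lemma kronecker_multiple_notin_diff_layer:
  fixes K :: "'a::topological_ab_group_add set" and m n :: nat
  assumes met: "metrizable_space (euclidean :: 'a topology)"
    and kron: "kronecker_set K" and xy: "x \<in> K" "y \<in> K" "x \<noteq> y" and m: "2 ^ n < m"
  shows "(\<Sum>i<m. x - y) \<notin> diff_layer K n"
proof
  assume z: "(\<Sum>i<m. x - y) \<in> diff_layer K n"
  have t1: "t1_space (euclidean :: 'a topology)"
    using met by (simp add: metrizable_imp_Hausdorff_space Hausdorff_imp_t1_space)
  obtain g :: "'a \<Rightarrow> real" where g: "continuous_map euclidean (top_of_set {0..1}) g"
      "g ` {y} \<subseteq> {0}" "g ` {x} \<subseteq> {1}"
  proof (rule Urysohn_lemma[of "euclidean :: 'a topology" "{y}" "{x}" 0 1])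
    show "normal_space (euclidean :: 'a topology)"
      by (rule metrizable_imp_normal_space[OF met])
    show "closedin (euclidean :: 'a topology) {y}" "closedin (euclidean :: 'a topology) {x}"
      using t1 by (auto simp: t1_space_closedin_singleton)
  qed (use xy in auto)
  have g01: "0 \<le> g k" "g k \<le> 1" for k
    using g(1) by (auto simp: continuous_map_in_subtopology)
  define h where "h k = g k / m" for k
  have "continuous_on UNIV g"
    using g(1) by (simp add: continuous_map_in_subtopology)
  then have "continuous_on K g" by (rule continuous_on_subset) simp
  then have "continuous_on K (\<lambda>k. cis (h k))"
    unfolding h_def cis_conv_exp using m by (intro continuous_intros) auto
  then obtain \<phi> where \<phi>: "\<And>j. \<phi> j \<in> character_group"
      and lim: "\<And>k. k \<in> K \<Longrightarrow> (\<lambda>j::nat. \<phi> j k) \<longlonglongrightarrow> cis (h k)"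
    by (rule kronecker_characters_tendsto[OF kron]) auto
  have "\<bar>h k\<bar> \<le> 1 / m" for k
    using g01[of k] m by (simp add: h_def divide_right_mono)
  then obtain s where s: "\<bar>s\<bar> \<le> 2 ^ n * (1 / m)"
      and lim_s: "(\<lambda>j. \<phi> j (\<Sum>i<m. x - y)) \<longlonglongrightarrow> cis s"
    using diff_layer_limit_angle[OF \<phi> lim _ _ z, of "1 / m"] by auto
  have "(\<lambda>j. (\<phi> j x / \<phi> j y) ^ m) \<longlonglongrightarrow> (cis (h x) / cis (h y)) ^ m"
    by (intro tendsto_intros lim xy) simp
  also have "(cis (h x) / cis (h y)) ^ m = cis 1"
    using g(2,3) m by (simp add: h_def Complex.DeMoivre)
  finally have "cis s = cis 1"
    using lim_s by (simp add: character_multiple[OF \<phi>] character_diff[OF \<phi>] LIMSEQ_unique)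
  \<comment> \<open>The cosine is injective on \<open>[0, pi]\<close>, which contains \<open>1\<close> and \<open>\<bar>s\<bar>\<close>.\<close>
  then have "cos \<bar>s\<bar> = cos 1" by (metis cis.sel(1) cos_abs_real)
  moreover have "real (2 ^ n) < real m"
    using m by (rule of_nat_less_iff[THEN iffD2])
  then have "2 ^ n * (1 / real m) < 1"
    by simp
  then have "\<bar>s\<bar> < 1"
    using s by (rule le_less_trans[rotated])
  then have "cos 1 < cos \<bar>s\<bar>"
    using pi_gt3 by (intro cos_monotone_0_pi) auto
  ultimately show False by simp
qed

section \<open>Baire category in a finer Polish group topology\<close>

lemma continuous_map_multiple_diff:
  fixes m :: nat
  assumes \<tau>: "polish_group_topology_on G \<tau>" and x: "x \<in> G" 
  shows "continuous_map \<tau> \<tau> (\<lambda>z. \<Sum>i<m. z - x)"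
proof -
  have add: "continuous_map \<tau> \<tau> (\<lambda>z. f z + g z)"
    if "continuous_map \<tau> \<tau> f" "continuous_map \<tau> \<tau> g" for f g
  proof -
    have "continuous_map \<tau> (prod_topology \<tau> \<tau>) (\<lambda>z. (f z, g z))"
      using that by (simp add: continuous_map_paired)
    moreover have "continuous_map (prod_topology \<tau> \<tau>) \<tau> (\<lambda>(x, y). x + y)"
      using \<tau> by (simp add: polish_group_topology_on_def)
    ultimately have "continuous_map \<tau> \<tau> ((\<lambda>(x, y). x + y) \<circ> (\<lambda>z. (f z, g z)))"
      by (rule continuous_map_compose)
    then show ?thesis by (simp add: o_def)
  qed
  have minus: "continuous_map \<tau> \<tau> uminus" and top: "topspace \<tau> = G"
    using \<tau> by (simp_all add: polish_group_topology_on_def)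
  then have mx: "- x \<in> topspace \<tau>"
    using x by (auto simp: continuous_map_def)
  have diff: "continuous_map \<tau> \<tau> (\<lambda>z. z - x)"
    using add[of "\<lambda>z. z" "\<lambda>z. - x"] mx by simp
  have "0 \<in> topspace \<tau>"
    using Pi_mem[OF continuous_map_funspace[OF diff], of x] x top by simp
  then show ?thesis
    by (induction m) (auto intro!: add diff)
qed

text \<open>By Baire, some layer has interior in the finer topology, so the next layer is a neighbourhood
  of \<open>0\<close>.  If \<open>m\<close> is chosen for that layer, then \<open>m (z - x)\<close> lies outside this neighbourhood for every
  \<open>z \<in> K\<close> other than \<open>x\<close>.  Since \<open>z \<mapsto> m (z - x)\<close> is continuous and \<open>m\<close> does not depend on \<open>z\<close>, the
  point \<open>x\<close> is isolated in \<open>K\<close> for the finer topology.  A discrete subset of a second countable space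
  is countable.\<close>

lemma not_polishable_if_multiples_leave_diff_layers:
  fixes K :: "'a::topological_ab_group_add set"
  assumes met: "metrizable_space (euclidean :: 'a topology)"
    and K: "compact K" "uncountable K"
    and indep: "\<And>n. \<exists>m::nat. \<forall>x\<in>K. \<forall>y\<in>K. x \<noteq> y \<longrightarrow> (\<Sum>i<m. x - y) \<notin> diff_layer K n"
  shows "\<not> polishable (group_closure K)"
proof
  let ?G = "group_closure K"
  assume "polishable ?G"
  then obtain \<tau> where \<tau>: "polish_group_topology_on ?G \<tau>"
      and incl: "continuous_map \<tau> euclidean (\<lambda>x. x)"
    unfolding polishable_def by blast
  from \<tau> have top: "topspace \<tau> = ?G" and cm: "completely_metrizable_space \<tau>"
      and sc: "second_countable \<tau>"
      and plus: "continuous_map (prod_topology \<tau> \<tau>) \<tau> (\<lambda>(x, y). x + y)"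
    by (simp_all add: polish_group_topology_on_def)
  have sub: "diff_layer K n \<subseteq> ?G" for n
    using group_closure_eq_UN_diff_layer[of K] by blast
  have closed: "closedin \<tau> (diff_layer K n)" for n
  proof -
    have "closed (diff_layer K n)"
      using compactin_imp_closedin[OF metrizable_imp_Hausdorff_space[OF met], of "diff_layer K n"]
        compact_diff_layer[OF K(1)] by simp
    then have "closedin \<tau> {x \<in> topspace \<tau>. x \<in> diff_layer K n}"
      using closedin_continuous_map_preimage[OF incl] by simp
    moreover have "{x \<in> topspace \<tau>. x \<in> diff_layer K n} = diff_layer K n"
      using sub top by auto
    ultimately show ?thesis by simp
  qed
  have "\<exists>n. \<tau> interior_of diff_layer K n \<noteq> {}"
  proof (rule ccontr)
    assume "\<not> ?thesis"
    then have "\<tau> interior_of \<Union>(range (diff_layer K)) = {}"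
      using cm closed by (intro Baire_category_alt) auto
    then have "topspace \<tau> = {}"
      by (metis group_closure_eq_UN_diff_layer interior_of_topspace top)
    then show False using top zero_in_group_closure[of K] by blast
  qed
  then obtain n p where p: "p \<in> \<tau> interior_of diff_layer K n" by blast
  \<comment> \<open>Translating by an interior point \<open>p\<close> of the layer \<open>n\<close> costs one step in the layers.\<close>
  define U where "U = {z \<in> topspace \<tau>. z + p \<in> \<tau> interior_of diff_layer K n}"
  have pG: "p \<in> diff_layer K n" "p \<in> topspace \<tau>"
    using p interior_of_subset[of \<tau> "diff_layer K n"] sub top by auto
  have "continuous_map \<tau> \<tau> (\<lambda>z. z + p)"
  proof -
    have "continuous_map \<tau> (prod_topology \<tau> \<tau>) (\<lambda>z. (z, p))"
      using pG by (simp add: continuous_map_paired)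
    from continuous_map_compose[OF this plus] show ?thesis by (simp add: o_def)
  qed
  then have openU: "openin \<tau> U"
    unfolding U_def by (rule openin_continuous_map_preimage) simp
  have U: "U \<subseteq> diff_layer K (Suc n)"
  proof
    fix z assume "z \<in> U"
    then have "z + p \<in> diff_layer K n"
      using interior_of_subset[of \<tau> "diff_layer K n"] by (auto simp: U_def)
    then have "(z + p) - p \<in> diff_layer K (Suc n)" using pG by force
    then show "z \<in> diff_layer K (Suc n)" by simp
  qed
  obtain m :: nat where m: "\<And>x y. \<lbrakk>x \<in> K; y \<in> K; x \<noteq> y\<rbrakk> \<Longrightarrow> (\<Sum>i<m. x - y) \<notin> diff_layer K (Suc n)"
    using indep by blast
  have KG: "K \<subseteq> ?G" by (auto intro: group_closure.base)
  have "openin (subtopology \<tau> K) {x}" if x: "x \<in> K" for x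
  proof -
    let ?W = "{z \<in> topspace \<tau>. (\<Sum>i<m. z - x) \<in> U}"
    have "openin \<tau> ?W"
      using x KG by (intro openin_continuous_map_preimage[OF continuous_map_multiple_diff[OF \<tau>] openU]) auto
    moreover have "{x} = ?W \<inter> K"
    proof -
      have "0 \<in> U" using p zero_in_group_closure[of K] by (simp add: U_def top)
      then have "x \<in> ?W" using x KG top by auto
      moreover have "z = x" if "z \<in> ?W" "z \<in> K" for z
        using m[of z x] that U x by auto
      ultimately show ?thesis using x by blast
    qed
    ultimately show ?thesis unfolding openin_subtopology by blast
  qed
  then have "subtopology \<tau> K = discrete_topology K"
    using KG top discrete_topology_unique[of K "subtopology \<tau> K"] by auto
  then have "countable K"
    using second_countable_subtopology[OF sc, of K] by (simp add: second_countable_discrete_topology)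
  with K(2) show False by simp
qed

theorem kronecker_not_polishable:
  fixes K :: "'a::topological_ab_group_add set"
  assumes met: "metrizable_space (euclidean :: 'a topology)"
    and kron: "kronecker_set K" and "uncountable K"
  shows "\<not> polishable (group_closure K)"
proof (rule not_polishable_if_multiples_leave_diff_layers)
  show "\<exists>m::nat. \<forall>x\<in>K. \<forall>y\<in>K. x \<noteq> y \<longrightarrow> (\<Sum>i<m. x - y) \<notin> diff_layer K n" for n
    using kronecker_multiple_notin_diff_layer[OF met kron, of _ _ n "Suc (2 ^ n)"] by blast
qed (use assms in \<open>auto simp: kronecker_set_def\<close>)

section \<open>Second countable and completely metrizable spaces\<close>

text \<open>The balls of radius \<open>1/(j+1)\<close> around the points of a countable \<open>1/(j+1)\<close>-net, for all \<open>j\<close>,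
  form a countable base.  Nets are convenient here because they come directly from total boundedness
  on compact spaces, and can be written down for convergent sequences.\<close>

lemma (in Metric_space) second_countable_if_countable_nets:
  assumes nets: "\<And>e. 0 < e \<Longrightarrow> \<exists>C. countable C \<and> M \<subseteq> (\<Union>c\<in>C. mball c e)"
  shows "second_countable mtopology"
proof -
  obtain C where C: "\<And>j. countable (C j)"
      "\<And>j. M \<subseteq> (\<Union>c\<in>C j. mball c (inverse (of_nat (Suc j))))"
    using nets[of "inverse (of_nat (Suc _))"] by (metis inverse_positive_iff_positive of_nat_0_less_iff zero_less_Suc)
  define \<B> where "\<B> = (\<Union>j. (\<lambda>c. mball c (inverse (of_nat (Suc j)))) ` C j)"
  show ?thesis
    unfolding second_countable_def
  proof (intro exI[of _ \<B>] conjI ballI allI impI)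
    show "countable \<B>" using C(1) by (auto simp: \<B>_def)
    show "openin mtopology V" if "V \<in> \<B>" for V using that by (auto simp: \<B>_def)
    fix U x assume "openin mtopology U \<and> x \<in> U"
    then obtain r where r: "r > 0" "mball x r \<subseteq> U" "x \<in> M" 
      unfolding openin_mtopology by blast
    obtain j where j: "inverse (of_nat (Suc j)) < r / 2"
      using reals_Archimedean[of "r / 2"] r(1) by auto
    obtain c where c: "c \<in> C j" "x \<in> mball c (inverse (of_nat (Suc j)))"
      using C(2)[of j] r(3) by blast
    have "mball c (inverse (of_nat (Suc j))) \<subseteq> mball x r"
      using c(2) j by (intro mball_subset) (auto simp: commute)
    with c r(2) show "\<exists>V\<in>\<B>. x \<in> V \<and> V \<subseteq> U"
      unfolding \<B>_def by (intro bexI[of _ "mball c (inverse (of_nat (Suc j)))"]) auto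
  qed
qed

lemma compact_metrizable_imp_second_countable:
  assumes "compact_space X" "metrizable_space X"
  shows "second_countable X"
proof -
  obtain M d where Md: "Metric_space M d" and X: "X = Metric_space.mtopology M d"
    using assms(2) unfolding metrizable_space_def by blast
  interpret Metric_space M d by (rule Md)
  have "mtotally_bounded M"
    using assms(1) X by (simp add: compact_space_eq_mcomplete_mtotally_bounded)
  then have "\<exists>C. countable C \<and> M \<subseteq> (\<Union>c\<in>C. mball c e)" if "0 < e" for e
    using that unfolding mtotally_bounded_def by (metis countable_finite)
  then show ?thesis
    unfolding X by (rule second_countable_if_countable_nets)
qed

lemma compact_metrizable_imp_completely_metrizable:
  assumes "compact_space X" "metrizable_space X"
  shows "completely_metrizable_space X"
proof -
  obtain M d where Md: "Metric_space M d" and X: "X = Metric_space.mtopology M d"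
    using assms(2) unfolding metrizable_space_def by blast
  interpret Metric_space M d by (rule Md)
  show ?thesis
    unfolding X using assms(1) X
    by (intro completely_metrizable_space_mtopology compact_space_imp_mcomplete) simp
qed

lemma second_countable_prod_topology:
  assumes "second_countable X" "second_countable Y"
  shows "second_countable (prod_topology X Y)"
proof -
  obtain \<B> where \<B>: "countable \<B>" "\<And>V. V \<in> \<B> \<Longrightarrow> openin X V"
    "\<And>U x. openin X U \<Longrightarrow> x \<in> U \<Longrightarrow> (\<exists>V \<in> \<B>. x \<in> V \<and> V \<subseteq> U)"
    using assms(1) by (metis second_countable_def)
  obtain \<C> where \<C>: "countable \<C>" "\<And>V. V \<in> \<C> \<Longrightarrow> openin Y V"
    "\<And>U x. openin Y U \<Longrightarrow> x \<in> U \<Longrightarrow> (\<exists>V \<in> \<C>. x \<in> V \<and> V \<subseteq> U)"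
    using assms(2) by (metis second_countable_def)
  show ?thesis
    unfolding second_countable_def
  proof (intro exI[of _ "(\<lambda>(B, C). B \<times> C) ` (\<B> \<times> \<C>)"] conjI ballI allI impI)
    show "countable ((\<lambda>(B, C). B \<times> C) ` (\<B> \<times> \<C>))" using \<B>(1) \<C>(1) by simp
    show "openin (prod_topology X Y) V" if "V \<in> (\<lambda>(B, C). B \<times> C) ` (\<B> \<times> \<C>)" for V
      using that \<B>(2) \<C>(2) by (auto simp: openin_prod_Times_iff)
    fix U p assume "openin (prod_topology X Y) U \<and> p \<in> U"
    then obtain S T where ST: "openin X S" "openin Y T" "fst p \<in> S" "snd p \<in> T" "S \<times> T \<subseteq> U"
      unfolding openin_prod_topology_alt by (metis prod.collapse)
    then obtain B C where BC: "B \<in> \<B>" "fst p \<in> B" "B \<subseteq> S" "C \<in> \<C>" "snd p \<in> C" "C \<subseteq> T"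
      by (metis \<B>(3) \<C>(3))
    then have "B \<times> C \<in> (\<lambda>(B, C). B \<times> C) ` (\<B> \<times> \<C>)" "p \<in> B \<times> C" "B \<times> C \<subseteq> U"
      using ST(5) by (auto simp: mem_Times_iff)
    then show "\<exists>V\<in>(\<lambda>(B, C). B \<times> C) ` (\<B> \<times> \<C>). p \<in> V \<and> V \<subseteq> U" by blast
  qed
qed

lemma continuous_map_Pair_euclidean:
  assumes "continuous_map X euclidean f" "continuous_map X euclidean g"
  shows "continuous_map X euclidean (\<lambda>x. (f x, g x))"
  using continuous_map_pairedI[OF assms] by simp

text \<open>This is how the group operations are seen to be continuous for the uniform distance of
  orbits of characters, which is subadditive under addition of points.\<close>

lemma continuous_map_dist_dominated:
  fixes f :: "'a \<Rightarrow> 'b::metric_space" and a :: "'a \<Rightarrow> 'c::metric_space" and b :: "'a \<Rightarrow> 'd::metric_space"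
  assumes a: "continuous_map X euclidean a" and b: "continuous_map X euclidean b"
    and dom: "\<And>p q. p \<in> topspace X \<Longrightarrow> q \<in> topspace X \<Longrightarrow>
      dist (f q) (f p) \<le> dist (a q) (a p) + dist (b q) (b p)"
  shows "continuous_map X euclidean f"
  unfolding continuous_map_atin limitin_canonical_iff
proof
  fix p assume p: "p \<in> topspace X"
  have "(a \<longlongrightarrow> a p) (atin X p)" "(b \<longlongrightarrow> b p) (atin X p)"
    using a b p by (simp_all add: continuous_map_atin)
  then have "((\<lambda>q. dist (a q) (a p) + dist (b q) (b p)) \<longlongrightarrow> 0 + 0) (atin X p)"
    by (intro tendsto_add) (simp_all flip: tendsto_dist_iff)
  then have lim: "((\<lambda>q. dist (a q) (a p) + dist (b q) (b p)) \<longlongrightarrow> 0) (atin X p)"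
    by simp
  have "\<forall>\<^sub>F q in atin X p. norm (dist (f q) (f p)) \<le> dist (a q) (a p) + dist (b q) (b p)"
    unfolding eventually_atin using dom[OF p] p by (intro disjI2 exI[of _ "topspace X"]) simp
  from Lim_null_comparison[OF this lim]
  show "(f \<longlongrightarrow> f p) (atin X p)" by (simp flip: tendsto_dist_iff)
qed

lemma inj_on_pullback_homeomorphic_space:
  assumes inj: "inj_on f A" and fA: "f ` A \<subseteq> topspace T"
  shows "pullback_topology A f T homeomorphic_space subtopology T (f ` A)"
  unfolding homeomorphic_space_def homeomorphic_maps_def
proof (intro exI conjI)
  have top: "topspace (pullback_topology A f T) = A"
    using fA by (auto simp: topspace_pullback_topology)
  show "continuous_map (pullback_topology A f T) (subtopology T (f ` A)) f"
    using continuous_map_pullback[OF continuous_map_id, of A f T] top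
    by (auto simp: continuous_map_in_subtopology id_def o_def)
  have "continuous_map (subtopology T (f ` A)) T (f \<circ> inv_into A f)"
    by (rule continuous_map_eq[of _ _ "\<lambda>x. x"]) (auto simp: f_inv_into_f intro: continuous_map_from_subtopology)
  then show "continuous_map (subtopology T (f ` A)) (pullback_topology A f T) (inv_into A f)"
    by (rule continuous_map_pullback') (auto intro: inv_into_into)
qed (use inj fA in \<open>auto simp: topspace_pullback_topology f_inv_into_f\<close>)

lemma completely_metrizable_bcontfun:
  "completely_metrizable_space (euclidean :: ('a::topological_space \<Rightarrow>\<^sub>C 'b::complete_space) topology)"
proof -
  have "\<exists>l. f \<longlonglongrightarrow> l" if "Cauchy f" for f :: "nat \<Rightarrow> 'a \<Rightarrow>\<^sub>C 'b"
  proof -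
    have "\<exists>N. \<forall>m n x. N \<le> m \<and> N \<le> n \<and> True \<longrightarrow> dist (f m x) (f n x) < e" if "0 < e" for e
      using metric_CauchyD[OF \<open>Cauchy f\<close> that] by (meson dist_fun_lt_imp_dist_val_lt)
    then obtain g where "uniform_limit UNIV (\<lambda>n. apply_bcontfun (f n)) g sequentially"
      using uniformly_convergent_eq_cauchy[of "\<lambda>_. True" "\<lambda>n. apply_bcontfun (f n)"]
      by (auto simp: uniform_limit_sequentially_iff)
    then show ?thesis
      using uniform_limit_bcontfunE[OF _ sequentially_bot] by blast
  qed
  then have "Metric_space.mcomplete (UNIV :: ('a \<Rightarrow>\<^sub>C 'b) set) dist"
    by (simp add: complete_def)
  then show ?thesis
    using Met_TC.completely_metrizable_space_mtopology[where 'a = "'a \<Rightarrow>\<^sub>C 'b"] by simp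
qed

section \<open>Characterized subgroups are polishable\<close>

text \<open>The discrete space \<^typ>\<open>nat\<close> makes every bounded sequence a bounded continuous function, so
  this is the affine copy \<open>1 + c\<^sub>0\<close> of the space of null sequences, with the supremum metric.\<close>

definition sequences_to_one :: "(nat \<Rightarrow>\<^sub>C complex) set" where
  "sequences_to_one = {g. apply_bcontfun g \<longlonglongrightarrow> 1}"

lemma continuous_on_apply_bcontfun_at: "continuous_on S (\<lambda>g. apply_bcontfun g n)"
  unfolding continuous_on_iff by (blast intro: dist_fun_lt_imp_dist_val_lt)

lemma closed_sequences_to_one: "closed sequences_to_one"
proof (rule closed_sequential_limits[THEN iffD2], intro allI impI, elim conjE)
  fix G g assume G: "\<forall>k. G k \<in> sequences_to_one" and "G \<longlonglongrightarrow> g"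
  have "apply_bcontfun g \<longlonglongrightarrow> 1"
  proof (rule metric_LIMSEQ_I)
    fix e :: real assume "e > 0"
    then obtain k where k: "dist (G k) g < e / 2"
      using \<open>G \<longlonglongrightarrow> g\<close> by (meson half_gt_zero lim_sequentially order_refl)
    have "apply_bcontfun (G k) \<longlonglongrightarrow> 1" using G by (simp add: sequences_to_one_def)
    then obtain N where N: "\<And>n. n \<ge> N \<Longrightarrow> dist (G k n) 1 < e / 2"
      using \<open>e > 0\<close> by (meson half_gt_zero lim_sequentially)
    have "dist (g n) 1 < e" if "n \<ge> N" for n
      using dist_bounded[of "G k" n g] k N[OF that] dist_triangle3[of "g n" 1 "G k n"] by linarith
    then show "\<exists>N. \<forall>n\<ge>N. dist (g n) 1 < e" by blast
  qed
  then show "g \<in> sequences_to_one" by (simp add: sequences_to_one_def)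
qed

text \<open>The whole space of bounded sequences is not separable.  A sequence that tends to \<open>1\<close> is however
  uniformly close to one that takes finitely many values from a countable dense set and then stays
  at \<open>1\<close>.\<close>

lemma second_countable_sequences_to_one:
  "second_countable (top_of_set sequences_to_one)"
proof -
  let ?Z = sequences_to_one
  obtain D :: "complex set" where D: "countable D" "\<And>V. open V \<Longrightarrow> V \<noteq> {} \<Longrightarrow> \<exists>d\<in>D. d \<in> V"
    using countable_dense_setE by metis
  define q where "q l = Bcontfun (\<lambda>n. if n < length l then l ! n else (1::complex))" for l
  have q: "apply_bcontfun (q l) n = (if n < length l then l ! n else 1)" for l n
  proof -
    have "range (\<lambda>n. if n < length l then l ! n else 1) \<subseteq> insert 1 (set l)" by auto
    then have "bounded (range (\<lambda>n. if n < length l then l ! n else 1))"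
      by (rule bounded_subset[rotated]) (simp add: finite_imp_bounded)
    then have "(\<lambda>n. if n < length l then l ! n else (1::complex)) \<in> bcontfun"
      by (simp add: bcontfun_def)
    then show ?thesis by (simp add: q_def Bcontfun_inverse)
  qed
  have qZ: "q l \<in> ?Z" for l
  proof -
    have "eventually (\<lambda>n. apply_bcontfun (q l) n = 1) sequentially"
      using eventually_ge_at_top[of "length l"] by eventually_elim (simp add: q)
    then show ?thesis by (simp add: sequences_to_one_def tendsto_eventually)
  qed
  interpret Submetric UNIV dist ?Z by unfold_locales auto
  have "\<exists>C. countable C \<and> ?Z \<subseteq> (\<Union>c\<in>C. sub.mball c e)" if "0 < e" for e
  proof (intro exI conjI)
    show "countable (q ` lists D)" using D(1) by simp
    show "?Z \<subseteq> (\<Union>c\<in>q ` lists D. sub.mball c e)"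
    proof
      fix g assume g: "g \<in> ?Z"
      then have "apply_bcontfun g \<longlonglongrightarrow> 1" by (simp add: sequences_to_one_def)
      then obtain N where N: "\<And>n. n \<ge> N \<Longrightarrow> dist (g n) 1 < e / 2"
        using \<open>0 < e\<close> by (meson half_gt_zero lim_sequentially)
      have "\<exists>d\<in>D. dist (g n) d < e / 2" for n
        using D(2)[of "ball (g n) (e / 2)"] \<open>0 < e\<close> by auto
      then obtain d where d: "\<And>n. d n \<in> D" "\<And>n. dist (g n) (d n) < e / 2" by metis
      define l where "l = map d [0..<N]"
      have "l \<in> lists D" using d(1) by (auto simp: l_def)
      have "dist (q l) g \<le> e / 2"
        by (rule dist_bound) (use d(2) N in \<open>auto simp: q l_def dist_commute intro: less_imp_le\<close>)
      then have "g \<in> sub.mball (q l) e"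
        using g qZ \<open>0 < e\<close> by simp
      with \<open>l \<in> lists D\<close> show "g \<in> (\<Union>c\<in>q ` lists D. sub.mball c e)" by blast
    qed
  qed
  then have "second_countable sub.mtopology"
    by (rule sub.second_countable_if_countable_nets)
  then show ?thesis by (simp add: mtopology_submetric)
qed

text \<open>Identify \<open>x \<in> s_set u\<close> with the pair of \<open>x\<close> and the sequence \<open>(u n x)\<close>.  This embeds the
  group as a closed subset of \<open>X \<times> (1 + c\<^sub>0)\<close>, which is Polish; pulling the topology back refines the
  given one by uniform closeness of the sequences \<open>(u n x)\<close>.  Closedness needs the uniform topology:
  it is what keeps the limit of sequences tending to \<open>1\<close> among the sequences tending to \<open>1\<close>.\<close>

lemma characterized_imp_polishable:
  fixes G :: "'a::topological_ab_group_add set"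
  assumes comp: "compact (UNIV :: 'a set)" and met: "metrizable_space (euclidean :: 'a topology)"
    and "characterized G"
  shows "polishable G"
proof -
  obtain u where u: "\<And>n. u n \<in> character_group" and G: "G = s_set u"
    using \<open>characterized G\<close> unfolding characterized_def by blast
  define V where "V x = Bcontfun (\<lambda>n. u n x)" for x
  have V: "apply_bcontfun (V x) n = u n x" for x n
  proof -
    have "bounded (range (\<lambda>n. u n x))"
      by (auto intro!: boundedI[of _ 1] simp: norm_character[OF u])
    then show ?thesis by (simp add: V_def bcontfun_def Bcontfun_inverse)
  qed
  define F where "F x = (x, V x)" for x
  define \<tau> where "\<tau> = pullback_topology G F euclidean"
  have top: "topspace \<tau> = G" by (simp add: \<tau>_def topspace_pullback_topology)
  let ?Z = sequences_to_one
  \<comment> \<open>Each condition on the right is closed, since evaluation at \<open>n\<close> and \<open>u n\<close> are continuous.\<close>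
  have "F ` G = (\<Inter>n. {p. apply_bcontfun (snd p) n = u n (fst p)}) \<inter> UNIV \<times> ?Z"
  proof (intro equalityI subsetI)
    fix p assume "p \<in> F ` G"
    then obtain x where x: "p = F x" "(\<lambda>n. u n x) \<longlonglongrightarrow> 1" by (auto simp: G s_set_def)
    moreover have "apply_bcontfun (V x) = (\<lambda>n. u n x)" by (simp add: V fun_eq_iff)
    ultimately show "p \<in> (\<Inter>n. {p. apply_bcontfun (snd p) n = u n (fst p)}) \<inter> UNIV \<times> ?Z"
      by (auto simp: F_def sequences_to_one_def)
  next
    fix p :: "'a \<times> (nat \<Rightarrow>\<^sub>C complex)"
    assume p: "p \<in> (\<Inter>n. {p. apply_bcontfun (snd p) n = u n (fst p)}) \<inter> UNIV \<times> ?Z"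
    then have "apply_bcontfun (snd p) = (\<lambda>n. u n (fst p))" by auto
    moreover from this have "snd p = V (fst p)" by (intro bcontfun_eqI) (simp add: V)
    ultimately show "p \<in> F ` G"
      using p by (intro image_eqI[of _ _ "fst p"])
        (auto simp: F_def G s_set_def sequences_to_one_def prod_eq_iff)
  qed
  moreover have "closed {p::'a \<times> (nat \<Rightarrow>\<^sub>C complex). apply_bcontfun (snd p) n = u n (fst p)}" for n
    by (intro closed_Collect_eq continuous_on_compose2[OF continuous_on_apply_bcontfun_at[of UNIV]]
        continuous_on_compose2[OF continuous_on_character[OF u, of UNIV]] continuous_on_fst continuous_on_snd continuous_on_id) auto
  ultimately have closed: "closed (F ` G)" and subZ: "F ` G \<subseteq> UNIV \<times> ?Z"
    by (auto intro!: closed_INT closed_Int closed_Times closed_sequences_to_one)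
  have homeo: "\<tau> homeomorphic_space top_of_set (F ` G)"
    unfolding \<tau>_def by (rule inj_on_pullback_homeomorphic_space) (auto simp: F_def inj_on_def)
  have cs: "compact_space (euclidean :: 'a topology)"
    using comp by (simp add: compact_space_def)
  have "completely_metrizable_space
      (prod_topology (euclidean :: 'a topology) (euclidean :: (nat \<Rightarrow>\<^sub>C complex) topology))"
    using compact_metrizable_imp_completely_metrizable[OF cs met]
      completely_metrizable_bcontfun[where 'a = nat and 'b = complex]
    by (simp only: completely_metrizable_space_prod_topology simp_thms)
  then have "completely_metrizable_space (euclidean :: ('a \<times> (nat \<Rightarrow>\<^sub>C complex)) topology)"
    by simp
  then have cm: "completely_metrizable_space \<tau>"
    using closed homeomorphic_completely_metrizable_space[OF homeo] 
    by (simp add: completely_metrizable_space_closedin)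
  have "second_countable (prod_topology (euclidean :: 'a topology) (top_of_set ?Z))"
    using compact_metrizable_imp_second_countable[OF cs met] second_countable_sequences_to_one
    by (rule second_countable_prod_topology)
  also have "prod_topology (euclidean :: 'a topology) (top_of_set ?Z) = top_of_set (UNIV \<times> ?Z)"
    by (simp add: prod_topology_subtopology(2))
  finally have "second_countable (subtopology (top_of_set (UNIV \<times> ?Z)) (F ` G))"
    by (rule second_countable_subtopology)
  then have sc: "second_countable \<tau>"
    using subZ homeomorphic_space_second_countability[OF homeo]
    by (simp add: subtopology_subtopology Int_absorb1)
  have F: "continuous_map \<tau> euclidean F"
    using continuous_map_pullback[OF continuous_map_id, of G F euclidean]
    by (simp add: \<tau>_def)
  have incl: "continuous_map \<tau> euclidean (\<lambda>x. x)"
    using continuous_map_compose[OF F, of euclidean fst]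
    by (simp add: F_def o_def continuous_on_fst[OF continuous_on_id])
  have contV: "continuous_map \<tau> euclidean V"
    using continuous_map_compose[OF F, of euclidean snd]
    by (simp add: F_def o_def continuous_on_snd[OF continuous_on_id])
  \<comment> \<open>A map into \<open>\<tau>\<close> is continuous as soon as both components of the embedding are.\<close>
  have into: "continuous_map X \<tau> f"
    if "continuous_map X euclidean f" "continuous_map X euclidean (\<lambda>p. V (f p))"
      "f ` topspace X \<subseteq> G" for X and f :: "'b \<Rightarrow> 'a"
    unfolding \<tau>_def
  proof (rule continuous_map_pullback')
    show "continuous_map X euclidean (F \<circ> f)"
      using continuous_map_Pair_euclidean[OF that(1,2)] by (simp add: F_def o_def)
  qed (use that in auto)
  show ?thesis
    unfolding polishable_def polish_group_topology_on_def
  proof (intro exI[of _ \<tau>] conjI top cm sc incl)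
    have fst: "continuous_map (prod_topology \<tau> \<tau>) \<tau> fst" and snd: "continuous_map (prod_topology \<tau> \<tau>) \<tau> snd"
      by (auto intro: continuous_map_fst continuous_map_snd)
    have Vfst: "continuous_map (prod_topology \<tau> \<tau>) euclidean (\<lambda>p. V (fst p))"
      and Vsnd: "continuous_map (prod_topology \<tau> \<tau>) euclidean (\<lambda>p. V (snd p))"
      using continuous_map_compose[OF fst contV] continuous_map_compose[OF snd contV]
      by (simp_all add: o_def)
    have "continuous_map (prod_topology \<tau> \<tau>) \<tau> (\<lambda>p. fst p + snd p)"
    proof (rule into)
      have "continuous_map (prod_topology \<tau> \<tau>) euclidean (\<lambda>p. (fst p, snd p))"
        using continuous_map_Pair_euclidean[OF continuous_map_compose[OF fst incl]
            continuous_map_compose[OF snd incl]] by (simp add: o_def)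
      moreover have "continuous_map euclidean euclidean (\<lambda>p::'a \<times> 'a. fst p + snd p)"
        unfolding continuous_map_iff_continuous2 continuous_on_def by (intro ballI tendsto_intros)
      ultimately have "continuous_map (prod_topology \<tau> \<tau>) euclidean
          ((\<lambda>p. fst p + snd p) \<circ> (\<lambda>p. (fst p, snd p)))"
        by (rule continuous_map_compose)
      then show "continuous_map (prod_topology \<tau> \<tau>) euclidean (\<lambda>p. fst p + snd p)"
        by (simp add: o_def)
      show "continuous_map (prod_topology \<tau> \<tau>) euclidean (\<lambda>p. V (fst p + snd p))"
      proof (rule continuous_map_dist_dominated[OF Vfst Vsnd], rule dist_bound)
        fix p q :: "'a \<times> 'a" and n
        obtain a b a' b' where pq: "p = (a, b)" "q = (a', b')" by fastforce
        \<comment> \<open>Unimodularity makes the distance of products at most the sum of the distances.\<close>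
        have "u n a' * u n b' - u n a * u n b = (u n a' - u n a) * u n b' + u n a * (u n b' - u n b)"
          by (simp add: algebra_simps)
        then have "dist (u n a' * u n b') (u n a * u n b) \<le> dist (u n a') (u n a) + dist (u n b') (u n b)"
          unfolding dist_norm
          by (metis norm_triangle_ineq norm_mult norm_character[OF u] mult_1 mult_1_right)
        also have "\<dots> \<le> dist (V a') (V a) + dist (V b') (V b)"
          using dist_bounded[of "V a'" n "V a"] dist_bounded[of "V b'" n "V b"] by (simp add: V)
        finally show "dist (V (fst q + snd q) n) (V (fst p + snd p) n)
            \<le> dist (V (fst q)) (V (fst p)) + dist (V (snd q)) (V (snd p))"
          by (simp add: pq V character_add[OF u])
      qed
      show "(\<lambda>p. fst p + snd p) ` topspace (prod_topology \<tau> \<tau>) \<subseteq> G"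
        by (auto simp: top G s_set_def character_add[OF u] intro!: tendsto_eq_intros)
    qed
    then show "continuous_map (prod_topology \<tau> \<tau>) \<tau> (\<lambda>(x, y). x + y)"
      by (simp add: case_prod_unfold)
    show "continuous_map \<tau> \<tau> uminus"
    proof (rule into)
      have "continuous_map euclidean euclidean (uminus :: 'a \<Rightarrow> 'a)"
        unfolding continuous_map_iff_continuous2 continuous_on_def by (intro ballI tendsto_intros)
      from continuous_map_compose[OF incl this]
      show "continuous_map \<tau> euclidean (uminus :: 'a \<Rightarrow> 'a)"
        by (simp add: o_def)
      \<comment> \<open>Conjugation is an isometry, so inversion preserves the uniform distance.\<close>
      have um: "u n (- x) = cnj (u n x)" for n x
        using character_diff[OF u, of n 0 x] norm_character[OF u, of n x]
        by (simp add: character_zero[OF u] divide_conv_cnj)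
      show "continuous_map \<tau> euclidean (\<lambda>p. V (- p))"
      proof (rule continuous_map_dist_dominated[OF contV contV], rule dist_bound)
        fix p q :: 'a and n
        have "dist (V (- q) n) (V (- p) n) = dist (V q n) (V p n)"
          by (simp add: V um dist_norm flip: complex_cnj_diff)
        then show "dist (V (- q) n) (V (- p) n) \<le> dist (V q) (V p) + dist (V q) (V p)"
          using dist_bounded[of "V q" n "V p"] zero_le_dist[of "V q" "V p"] by linarith
      qed
      show "uminus ` topspace \<tau> \<subseteq> G"
      proof (rule image_subsetI)
        fix x assume "x \<in> topspace \<tau>"
        then have "(\<lambda>n. u n x) \<longlonglongrightarrow> 1" by (simp add: top G s_set_def)
        then have "(\<lambda>n. cnj (u n x)) \<longlonglongrightarrow> cnj 1" by (rule tendsto_cnj)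
        then show "- x \<in> G" by (simp add: G s_set_def um)
      qed
    qed
  qed
qed

section \<open>Uncountable Kronecker sets\<close>

theorem theorem2:
  fixes K :: "'a::topological_ab_group_add set"
  assumes "infinite (UNIV :: 'a set)"
    and "compact (UNIV :: 'a set)"
    and "metrizable_space (euclidean :: 'a topology)"
    and "kronecker_set K"
    and "uncountable K"
  shows "\<not> polishable (group_closure K) \<and> \<not> characterized (group_closure K)"
  using kronecker_not_polishable[OF assms(3-5)] characterized_imp_polishable[OF assms(2,3)] by blast

end
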